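(* Let $f:X\to Y$ be an injective continuous map and let $B\subseteq X$. Then $TC(X,B)\le TC^P(f,B)$, and equality holds if $f$ is the identity map of $X$.
   Context: For a topological space $X$, $PX=X^I$ is the space of continuous paths $[0,1]\to X$ with the compact-open topology. For $B\subseteq X$, $P_{X\times B}=\{\gamma\in PX : \gamma(1)\in B\}$ (subspace topology). For a continuous map $f:X\to Y$ and $B\subseteq X$, let $\pi_{f(B)}:P_{X\times B}\to X\times f(B)$, $\pi_{f(B)}(\gamma)=(\gamma(0),f(\gamma(1)))$. The targeted complexity $TC^P(f,B)$ is the least integer $n\ge 0$ such that there is an open cover $U_0,\dots,U_n$ of $X\times f(B)$ with, for each $i$, a continuous partial section $s_i:U_i\to P_{X\times B}$, i.e. $\pi_{f(B)}s_i=\mathrm{id}_{U_i}$; if no such $n$ exists, $TC^P(f,B)=\infty$. The relative topological complexity $TC(X,B)$ of the pair $(X,B)$ is the least integer $n\ge0$ such that $X\times B$ has an open cover $U_0,\dots,U_n$ with, over each $U_i$, a continuous section of $\pi_B:P_{X\times B}\to X\times B$, $\pi_B(\gamma)=(\gamma(0),\gamma(1))$ ($\infty$ if there is none). *)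

theory Defs
  imports "HOL-Analysis.Analysis" "HOL-Library.Extended_Nat"
begin

(* pathin only constrains a function on {0..1}; extensionality makes each path be
   represented by exactly one function. *)
definition paths :: "'a topology \<Rightarrow> (real \<Rightarrow> 'a) set" where
  "paths X = {\<gamma>. pathin X \<gamma> \<and> \<gamma> \<in> extensional {0..1}}"

(* PX with the compact-open topology. The subbasic sets cover PX (take U to be the whole
   space), so its carrier is the set of all paths; see topspace_path_space. *)
definition path_space :: "'a topology \<Rightarrow> (real \<Rightarrow> 'a) topology" where
  "path_space X = topology_generated_by
     {{\<gamma> \<in> paths X. \<gamma> ` K \<subseteq> U} | K U. compactin (top_of_set {0..1}) K \<and> openin X U}"

lemma topspace_path_space: "topspace (path_space X) = paths X"
proof
  show "topspace (path_space X) \<subseteq> paths X"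
    by (auto simp: path_space_def)
  show "paths X \<subseteq> topspace (path_space X)"
  proof
    fix \<gamma> assume "\<gamma> \<in> paths X"
    then have "\<gamma> \<in> {\<gamma> \<in> paths X. \<gamma> ` {} \<subseteq> topspace X}"
      by simp
    then show "\<gamma> \<in> topspace (path_space X)"
      unfolding path_space_def topology_generated_by_topspace
      using compactin_empty openin_topspace by blast
  qed
qed

(* the paths in X that end in B *)
definition paths_to :: "'a topology \<Rightarrow> 'a set \<Rightarrow> (real \<Rightarrow> 'a) topology" where
  "paths_to X B = subtopology (path_space X) {\<gamma>. \<gamma> 1 \<in> B}"

(* Z has an open cover U_0, ..., U_n with a continuous section of p : E -> Z over each U_i;
   the U_i may be empty or repeated. *)
definition section_cover :: "'e topology \<Rightarrow> 'z topology \<Rightarrow> ('e \<Rightarrow> 'z) \<Rightarrow> nat \<Rightarrow> bool" where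
  "section_cover E Z p n \<longleftrightarrow>
     (\<exists>U :: nat \<Rightarrow> 'z set.
        (\<forall>i\<le>n. openin Z (U i)) \<and>
        (\<Union>i\<le>n. U i) = topspace Z \<and>
        (\<forall>i\<le>n. \<exists>s. continuous_map (subtopology Z (U i)) E s \<and> (\<forall>z\<in>U i. p (s z) = z)))"

definition section_number :: "'e topology \<Rightarrow> 'z topology \<Rightarrow> ('e \<Rightarrow> 'z) \<Rightarrow> enat" where
  "section_number E Z p =
     (if \<exists>n. section_cover E Z p n then enat (LEAST n. section_cover E Z p n) else \<infinity>)"

(* TC(X,B) *)
definition relative_TC :: "'a topology \<Rightarrow> 'a set \<Rightarrow> enat" where
  "relative_TC X B =
     section_number (paths_to X B) (prod_topology X (subtopology X B)) (\<lambda>\<gamma>. (\<gamma> 0, \<gamma> 1))"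

(* TC^P(f,B) for f : X -> Y *)
definition targeted_TC :: "'a topology \<Rightarrow> 'b topology \<Rightarrow> ('a \<Rightarrow> 'b) \<Rightarrow> 'a set \<Rightarrow> enat" where
  "targeted_TC X Y f B =
     section_number (paths_to X B) (prod_topology X (subtopology Y (f ` B))) (\<lambda>\<gamma>. (\<gamma> 0, f (\<gamma> 1)))"

end

theory Submission
  imports Defs
begin

text \<open>
  A section cover can be pulled back along a continuous map \<open>h\<close> of base spaces: replace the open
  sets by their preimages and precompose the sections with \<open>h\<close>. If \<open>s\<close> is a partial section
  of \<open>p\<close>, then \<open>p (s (h z)) = h z\<close>; so \<open>s \<circ> h\<close> is a partial section of \<open>q\<close> as soon as
  \<open>p e = h z\<close> forces \<open>q e = z\<close>.

  For an injective \<open>f\<close> this applies to \<open>h (x, b) = (x, f b)\<close> from \<open>X \<times> B\<close> to \<open>X \<times> f(B)\<close>: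
  a path \<open>\<gamma>\<close> with \<open>\<gamma> 0 = x\<close> and \<open>f (\<gamma> 1) = f b\<close> satisfies \<open>\<gamma> 1 = b\<close>. The inverse of \<open>h\<close>
  may fail to be continuous, and therefore the argument gives only an inequality. For the identity
  the two base spaces and the two projections agree, so the pullback works in both directions.
\<close>

lemma section_cover_pullback:
  assumes cover: "section_cover E Z p n"
    and h: "continuous_map W Z h"
    and lift: "\<And>e w. \<lbrakk>e \<in> topspace E; w \<in> topspace W; p e = h w\<rbrakk> \<Longrightarrow> q e = w"
  shows "section_cover E W q n"
proof -
  obtain U where U_open: "\<And>i. i \<le> n \<Longrightarrow> openin Z (U i)"
    and U_cover: "(\<Union>i\<le>n. U i) = topspace Z"
    and U_section: "\<And>i. i \<le> n \<Longrightarrow>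
      \<exists>s. continuous_map (subtopology Z (U i)) E s \<and> (\<forall>z\<in>U i. p (s z) = z)"
    using cover unfolding section_cover_def by blast
  define V where "V i = {w \<in> topspace W. h w \<in> U i}" for i
  have V_open: "openin W (V i)" if "i \<le> n" for i
    using h U_open[OF that] unfolding V_def by (rule openin_continuous_map_preimage)
  have h_image: "h w \<in> topspace Z" if "w \<in> topspace W" for w
    using h that by (auto simp: continuous_map_def)
  have V_cover: "(\<Union>i\<le>n. V i) = topspace W"
    using h_image U_cover unfolding V_def by blast
  have V_section: "\<exists>t. continuous_map (subtopology W (V i)) E t \<and> (\<forall>w\<in>V i. q (t w) = w)"
    if i: "i \<le> n" for i
  proof -
    obtain s where s: "continuous_map (subtopology Z (U i)) E s"
      and ps: "\<And>z. z \<in> U i \<Longrightarrow> p (s z) = z"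
      using U_section[OF i] by blast
    have "continuous_map (subtopology W (V i)) (subtopology Z (U i)) h"
      using h by (auto simp: V_def continuous_map_in_subtopology continuous_map_from_subtopology)
    then have sh: "continuous_map (subtopology W (V i)) E (s \<circ> h)"
      using s by (rule continuous_map_compose)
    have "q ((s \<circ> h) w) = w" if w: "w \<in> V i" for w
    proof (rule lift)
      show "w \<in> topspace W"
        using w by (simp add: V_def)
      then show "(s \<circ> h) w \<in> topspace E"
        using sh w by (auto simp: continuous_map_def)
      show "p ((s \<circ> h) w) = h w"
        using w ps by (simp add: V_def)
    qed
    with sh show ?thesis
      by blast
  qed
  show ?thesis
    unfolding section_cover_def using V_open V_cover V_section by blast
qed

lemma section_number_pullback:
  assumes "continuous_map W Z h"
    and "\<And>e w. \<lbrakk>e \<in> topspace E; w \<in> topspace W; p e = h w\<rbrakk> \<Longrightarrow> q e = w"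
  shows "section_number E W q \<le> section_number E Z p"
proof (cases "\<exists>n. section_cover E Z p n")
  case True
  then have "section_cover E Z p (LEAST n. section_cover E Z p n)"
    by (rule LeastI_ex)
  then have "section_cover E W q (LEAST n. section_cover E Z p n)"
    using assms by (rule section_cover_pullback)
  then show ?thesis
    using True by (auto simp: section_number_def intro: Least_le)
qed (simp add: section_number_def)

lemma paths_to_endpoints:
  assumes "\<gamma> \<in> topspace (paths_to X B)"
  shows "\<gamma> 1 \<in> B" "\<gamma> 1 \<in> topspace X"
  using assms
  by (auto simp: paths_to_def topspace_path_space paths_def pathin_def continuous_map_def)

theorem proposition4p3:
  fixes X :: "'a topology" and Y :: "'b topology" and f :: "'a \<Rightarrow> 'b" and B :: "'a set"
  assumes "continuous_map X Y f"
    and "inj_on f (topspace X)"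
    and "B \<subseteq> topspace X"
  shows "relative_TC X B \<le> targeted_TC X Y f B
    \<and> (\<forall>g :: 'a \<Rightarrow> 'a. (\<forall>x\<in>topspace X. g x = x) \<longrightarrow> relative_TC X B = targeted_TC X X g B)"
proof (intro conjI allI impI)
  have f_B: "continuous_map (subtopology X B) (subtopology Y (f ` B)) f"
    using assms(1) by (auto simp: continuous_map_in_subtopology continuous_map_from_subtopology)
  show "relative_TC X B \<le> targeted_TC X Y f B"
    unfolding relative_TC_def targeted_TC_def
  proof (rule section_number_pullback)
    show "continuous_map (prod_topology X (subtopology X B))
        (prod_topology X (subtopology Y (f ` B))) (\<lambda>(x, b). (x, f b))"
      using f_B by (simp add: continuous_map_prod_top)
  next
    fix \<gamma> w
    assume \<gamma>: "\<gamma> \<in> topspace (paths_to X B)"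
      and w: "w \<in> topspace (prod_topology X (subtopology X B))"
      and eq: "(\<gamma> 0, f (\<gamma> 1)) = (\<lambda>(x, b). (x, f b)) w"
    show "(\<gamma> 0, \<gamma> 1) = w"
      using w eq paths_to_endpoints[OF \<gamma>] assms(2) by (auto dest: inj_onD)
  qed
next
  fix g :: "'a \<Rightarrow> 'a"
  assume g: "\<forall>x\<in>topspace X. g x = x"
  then have g_B: "g ` B = B"
    using assms(3) by force
  have g_end: "g (\<gamma> 1) = \<gamma> 1" if "\<gamma> \<in> topspace (paths_to X B)" for \<gamma>
    using g paths_to_endpoints(2)[OF that] by blast
  show "relative_TC X B = targeted_TC X X g B"
    unfolding relative_TC_def targeted_TC_def g_B
    by (rule antisym; rule section_number_pullback[where h = "\<lambda>w. w"]) (auto simp: g_end)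
qed

end
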